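(* Let $\mathsf{N}\subset\mathsf{H}$ be a closed subspace compatible with the isometry $\mathcal{U}:\mathsf{M}\to\mathsf{M}^\perp$, and let $g\in\mathrm{SL}_2(\mathbb{R})$. Then $\mathsf{N}^g=\{\mathcal{M}_{\mathcal{U}}(g)z\mid z\in\mathsf{N}\}$ is a closed subspace compatible with $\mathcal{U}$ as well.
   Context: $\mathsf{H}$ is a separable real Hilbert space (finite or infinite dimensional), $\mathsf{M}\subset\mathsf{H}$ is a closed subspace with $\dim\mathsf{M}=\dim\mathsf{M}^\perp$, and $\mathcal{U}:\mathsf{M}\to\mathsf{M}^\perp$ is a fixed unitary (isometric linear bijection). Elements of $\mathsf{H}=\mathsf{M}^\perp\oplus\mathsf{M}$ (orthogonal sum) are written $(y,x)$ with $y\in\mathsf{M}^\perp$, $x\in\mathsf{M}$. The symplectic form on $\mathsf{H}$ is $\omega((y,x);(y',x'))=\langle \mathcal{U}x,y'\rangle-\langle \mathcal{U}^*y,x'\rangle$. The symplectic complement of a subspace $\mathsf{L}$ is $\mathsf{L}^\circ=\{z\in\mathsf{H}\mid \omega(z;z')=0 \text{ for all } z'\in\mathsf{L}\}$; $\mathsf{L}$ is Lagrangian if $\mathsf{L}=\mathsf{L}^\circ$. A closed subspace of $\mathsf{H}$ is called compatible with $\mathcal{U}$ if it is Lagrangian with respect to $\omega$. For $g=\begin{pmatrix}a&b\\c&d\end{pmatrix}\in\mathrm{SL}_2(\mathbb{R})$ the operator $\mathcal{M}_{\mathcal{U}}(g):\mathsf{H}\to\mathsf{H}$ is $\mathcal{M}_{\mathcal{U}}(g)(y,x)=(ay+b\,\mathcal{U}x,\;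 c\,\mathcal{U}^*y+dx)$. *)

theory Defs
  imports "HOL-Analysis.Analysis"
begin

definition orthonormal_basis :: "'h::real_inner set \<Rightarrow> 'h set \<Rightarrow> bool" where
  "orthonormal_basis S B \<longleftrightarrow>
     pairwise orthogonal B \<and> (\<forall>b\<in>B. norm b = 1) \<and> closure (span B) = S"

text \<open>
  Equality of Hilbert space dimensions (cardinalities of orthonormal bases); the library
  function \<^const>\<open>dim\<close> is only meaningful in finite dimension.
\<close>
definition same_hilbert_dim :: "'h::real_inner set \<Rightarrow> 'h set \<Rightarrow> bool" where
  "same_hilbert_dim S T \<longleftrightarrow>
     (\<exists>B C. orthonormal_basis S B \<and> orthonormal_basis T C \<and> B \<approx> C)"

text \<open>
  Operators between subspaces are functions on the ambient space; only their values on the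
  domain subspace matter.
\<close>
definition unitary_between :: "'h::real_inner set \<Rightarrow> 'h set \<Rightarrow> ('h \<Rightarrow> 'h) \<Rightarrow> bool" where
  "unitary_between S T U \<longleftrightarrow>
     (\<forall>x\<in>S. \<forall>y\<in>S. U (x + y) = U x + U y) \<and>
     (\<forall>r. \<forall>x\<in>S. U (r *\<^sub>R x) = r *\<^sub>R U x) \<and>
     (\<forall>x\<in>S. norm (U x) = norm x) \<and>
     bij_betw U S T"

definition adjoint_on :: "'h::real_inner set \<Rightarrow> ('h \<Rightarrow> 'h) \<Rightarrow> 'h \<Rightarrow> 'h" where
  "adjoint_on S U y = (THE x. x \<in> S \<and> (\<forall>x'\<in>S. inner (U x') y = inner x' x))"

text \<open>
  The components of \<open>z = y + x\<close> with \<open>y \<in> M\<^sup>\<bottom>\<close> and \<open>x \<in> M\<close>. The decomposition exists for every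
  \<open>z\<close> when \<open>M\<close> is a closed subspace of a complete space.
\<close>
definition par_part :: "'h::real_inner set \<Rightarrow> 'h \<Rightarrow> 'h" where
  "par_part M z = (THE x. x \<in> M \<and> z - x \<in> M\<^sup>\<bottom>)"

definition perp_part :: "'h::real_inner set \<Rightarrow> 'h \<Rightarrow> 'h" where
  "perp_part M z = z - par_part M z"

definition symplectic_form :: "'h::real_inner set \<Rightarrow> ('h \<Rightarrow> 'h) \<Rightarrow> 'h \<Rightarrow> 'h \<Rightarrow> real" where
  "symplectic_form M U z z' =
     inner (U (par_part M z)) (perp_part M z')
     - inner (adjoint_on M U (perp_part M z)) (par_part M z')"

definition symplectic_complement :: "'h::real_inner set \<Rightarrow> ('h \<Rightarrow> 'h) \<Rightarrow> 'h set \<Rightarrow> 'h set" where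
  "symplectic_complement M U L = {z. \<forall>z'\<in>L. symplectic_form M U z z' = 0}"

definition lagrangian :: "'h::real_inner set \<Rightarrow> ('h \<Rightarrow> 'h) \<Rightarrow> 'h set \<Rightarrow> bool" where
  "lagrangian M U L \<longleftrightarrow> subspace L \<and> L = symplectic_complement M U L"

definition compatible_subspace :: "'h::real_inner set \<Rightarrow> ('h \<Rightarrow> 'h) \<Rightarrow> 'h set \<Rightarrow> bool" where
  "compatible_subspace M U N \<longleftrightarrow> closed N \<and> subspace N \<and> lagrangian M U N"

definition sl2_op :: "'h::real_inner set \<Rightarrow> ('h \<Rightarrow> 'h) \<Rightarrow> real^2^2 \<Rightarrow> 'h \<Rightarrow> 'h" where
  "sl2_op M U g z =
     (g$1$1 *\<^sub>R perp_part M z + g$1$2 *\<^sub>R U (par_part M z))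
     + (g$2$1 *\<^sub>R adjoint_on M U (perp_part M z) + g$2$2 *\<^sub>R par_part M z)"

lemma decomposition_parts:
  assumes M: "subspace M" and x: "x \<in> M" and y: "y \<in> M\<^sup>\<bottom>"
  shows "par_part M (y + x) = x" and "perp_part M (y + x) = y"
proof -
  show p: "par_part M (y + x) = x"
    unfolding par_part_def
  proof (rule the_equality)
    fix x' assume x': "x' \<in> M \<and> y + x - x' \<in> M\<^sup>\<bottom>"
    have "x - x' \<in> M" using M x x' by (simp add: subspace_diff)
    moreover have "x - x' \<in> M\<^sup>\<bottom>"
      using subspace_diff[OF subspace_orthogonal_comp, of "y + x - x'" M y] x' y
      by (simp add: algebra_simps)
    ultimately have "orthogonal (x - x') (x - x')"
      by (auto simp: orthogonal_comp_def)
    then show "x' = x" by (simp add: orthogonal_def)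
  qed (use x y in simp)
  show "perp_part M (y + x) = y" by (simp add: perp_part_def p)
qed

lemma adjoint_on_unitary:
  assumes S: "subspace S" and U: "unitary_between S T U" and x: "x \<in> S"
  shows "adjoint_on S U (U x) = x"
proof -
  have polar: "inner u v = ((norm (u + v))\<^sup>2 - (norm u)\<^sup>2 - (norm v)\<^sup>2) / 2" for u v :: 'a
    by (simp add: power2_norm_eq_inner inner_add_left inner_add_right inner_commute)
  have iso: "inner (U u) (U v) = inner u v" if uv: "u \<in> S" "v \<in> S" for u v
  proof -
    have "U u + U v = U (u + v)" using U uv by (simp add: unitary_between_def)
    moreover have "norm (U (u + v)) = norm (u + v)"
      using U subspace_add[OF S uv] by (simp add: unitary_between_def)
    moreover have "norm (U u) = norm u" "norm (U v) = norm v"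
      using U uv by (auto simp: unitary_between_def)
    ultimately show ?thesis by (simp add: polar)
  qed
  show ?thesis
    unfolding adjoint_on_def
  proof (rule the_equality)
    fix w assume w: "w \<in> S \<and> (\<forall>x'\<in>S. inner (U x') (U x) = inner x' w)"
    have d: "x - w \<in> S" using S x w by (simp add: subspace_diff)
    have "inner (x - w) x = inner (x - w) w" using w d x iso by metis
    then have "inner (x - w) (x - w) = 0" by (simp add: inner_diff_right)
    then show "w = x" by simp
  qed (use x iso in simp)
qed

end

theory Submission
  imports Defs
begin

text \<open>
  Identify \<open>M\<^sup>\<bottom>\<close> with \<open>M\<close> along \<open>U\<close>: every vector is \<open>U u + x\<close> for a pair \<open>(u, x)\<close> in
  \<open>M \<times> M\<close>. In these coordinates the adjoint disappears. The operator attached to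
  \<open>g = (a, b; c, d)\<close> becomes \<open>(u, x) \<mapsto> (a u + b x, c u + d x)\<close>, and the symplectic form becomes
  \<open>\<langle>x, u'\<rangle> - \<langle>u, x'\<rangle>\<close>, a skew pairing that the operator multiplies by \<open>det g\<close>. So for \<open>det g = 1\<close>
  the operator is a linear map that preserves the form, and it is onto because the adjugate matrix
  gives preimages. A surjective form-preserving map carries the complement of \<open>L\<close> to the
  complement of the image of \<open>L\<close>, hence Lagrangian subspaces to Lagrangian subspaces.

  Closedness comes for free, without any continuity estimate for the operator: for fixed
  \<open>z'\<close> the form is \<open>z \<mapsto> \<langle>z, u' - U x'\<rangle>\<close>, so a symplectic complement is an intersection
  of closed hyperplanes, and a Lagrangian subspace is such a complement.

  The coordinates exist because a closed subspace of a Hilbert space has an orthogonal projection;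
  this is the only place where completeness enters.
\<close>

section \<open>Orthogonal projection onto a closed subspace\<close>

lemma dist_parallelogram:
  fixes z m m' :: "'a::real_inner"
  shows "(dist m m')\<^sup>2
           = 2 * (dist z m)\<^sup>2 + 2 * (dist z m')\<^sup>2 - 4 * (dist z ((1/2) *\<^sub>R (m + m')))\<^sup>2"
  unfolding dist_norm power2_norm_eq_inner
  by (simp add: inner_diff_left inner_diff_right inner_add_left inner_add_right inner_commute
      field_simps)

text \<open>
  By the parallelogram law two almost-nearest points are close to each other, because their
  midpoint cannot be nearer than the infimum. The sets of \<open>1/(n+1)\<close>-almost-nearest points
  therefore shrink to a point.
\<close>
lemma nearest_point_closed_subspace:
  fixes M :: "'h::{real_inner, complete_space} set"
  assumes "closed M" "subspace M"
  obtains p where "p \<in> M" "\<And>m. m \<in> M \<Longrightarrow> dist z p \<le> dist z m"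
proof -
  have ne: "M \<noteq> {}" using subspace_0[OF assms(2)] by auto
  define d where "d = infdist z M"
  define S where "S n = {m \<in> M. (dist z m)\<^sup>2 \<le> d\<^sup>2 + 1 / real (Suc n)}" for n
  have d_le: "d \<le> dist z m" if "m \<in> M" for m
    unfolding d_def by (rule infdist_le[OF that])
  have d0: "0 \<le> d" by (simp add: d_def infdist_nonneg)
  have closedS: "closed (S n)" for n
  proof -
    have "S n = M \<inter> {m. (dist z m)\<^sup>2 \<le> d\<^sup>2 + 1 / real (Suc n)}" by (auto simp: S_def)
    moreover have "closed {m. (dist z m)\<^sup>2 \<le> d\<^sup>2 + 1 / real (Suc n)}"
      by (intro closed_Collect_le continuous_intros)
    ultimately show ?thesis using assms(1) by auto
  qed
  have neS: "S n \<noteq> {}" for n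
  proof -
    have "d < sqrt (d\<^sup>2 + 1 / real (Suc n))"
      using d0 by (intro real_less_rsqrt) auto
    then obtain m where m: "m \<in> M" "dist z m < sqrt (d\<^sup>2 + 1 / real (Suc n))"
      using cInf_lessD[of "dist z ` M"] ne unfolding d_def infdist_notempty[OF ne] by auto
    have "(dist z m)\<^sup>2 \<le> (sqrt (d\<^sup>2 + 1 / real (Suc n)))\<^sup>2"
      using m(2) by (intro power_mono) auto
    then show ?thesis using m(1) by (auto simp: S_def)
  qed
  have decS: "S n \<subseteq> S m" if "m \<le> n" for m n
  proof -
    have "1 / real (Suc n) \<le> 1 / real (Suc m)" using that by (simp add: frac_le)
    then show ?thesis by (auto simp: S_def)
  qed
  have small: "\<exists>n. \<forall>x\<in>S n. \<forall>y\<in>S n. dist x y < e" if "e > 0" for e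
  proof -
    have "0 < e\<^sup>2 / 4" using that by simp
    then obtain n where n: "1 / real (Suc n) < e\<^sup>2 / 4"
      using reals_Archimedean unfolding inverse_eq_divide by blast
    have "dist x y < e" if xy: "x \<in> S n" "y \<in> S n" for x y
    proof -
      have "(1/2) *\<^sub>R (x + y) \<in> M"
        using xy assms(2) by (auto simp: S_def intro!: subspace_scale subspace_add)
      then have "d\<^sup>2 \<le> (dist z ((1/2) *\<^sub>R (x + y)))\<^sup>2"
        using d_le d0 by (intro power_mono) auto
      then have "(dist x y)\<^sup>2 < e\<^sup>2"
        using dist_parallelogram[of x y z] xy n by (auto simp: S_def)
      then show ?thesis using \<open>e > 0\<close> by (simp add: power2_less_imp_less)
    qed
    then show ?thesis by blast
  qed
  obtain p where p: "\<And>n. p \<in> S n"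
    using decreasing_closed_nest[of S] closedS neS decS small by metis
  have "(dist z p)\<^sup>2 \<le> d\<^sup>2"
  proof (rule field_le_epsilon)
    fix e :: real assume "e > 0"
    then obtain n where "1 / real (Suc n) < e"
      using reals_Archimedean[of e] by (auto simp: inverse_eq_divide)
    then show "(dist z p)\<^sup>2 \<le> d\<^sup>2 + e" using p[of n] by (auto simp: S_def)
  qed
  then have "dist z p \<le> d" using d0 by (rule power2_le_imp_le)
  then show thesis
    using p[of 0] d_le by (intro that[of p]) (auto simp: S_def intro: order_trans)
qed

text \<open>
  For the nearest point \<open>p\<close> of a convex set, \<open>z - p\<close> makes no acute angle with any direction from
  \<open>p\<close> into the set; in a subspace both \<open>m\<close> and \<open>-m\<close> are such directions, so the angle is right.
\<close>
lemma orthogonal_decomposition_closed_subspace: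
  fixes M :: "'h::{real_inner, complete_space} set"
  assumes "closed M" "subspace M"
  obtains y x where "y \<in> M\<^sup>\<bottom>" "x \<in> M" "z = y + x"
proof -
  obtain p where p: "p \<in> M" and near: "\<And>m. m \<in> M \<Longrightarrow> dist z p \<le> dist z m"
    using nearest_point_closed_subspace[OF assms] by metis
  have le: "inner (z - p) m \<le> 0" if "m \<in> M" for m
    using any_closest_point_dot[OF subspace_imp_convex assms(1) p, of "p + m" z]
      near subspace_add[OF assms(2) p that] assms(2) by simp
  have "inner m (z - p) = 0" if "m \<in> M" for m
    using le[OF that] le[OF subspace_neg[OF assms(2) that]] by (simp add: inner_commute)
  then have "z - p \<in> M\<^sup>\<bottom>" by (auto simp: orthogonal_comp_def orthogonal_def)
  then show thesis using p by (intro that[of "z - p" p]) auto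
qed

section \<open>Coordinates along the unitary\<close>

lemma unitary_between_inner:
  assumes S: "subspace S" and U: "unitary_between S T U" and uv: "u \<in> S" "v \<in> S"
  shows "inner (U u) (U v) = inner u v"
proof -
  have "norm (U u + U v) = norm (u + v)" "norm (U u) = norm u" "norm (U v) = norm v"
    using U uv subspace_add[OF S uv] by (metis unitary_between_def)+
  then show ?thesis by (simp add: dot_norm)
qed

locale unitary_onto_complement =
  fixes M :: "'h::{real_inner, complete_space} set" and U :: "'h \<Rightarrow> 'h"
  assumes closed_M: "closed M" and subspace_M: "subspace M"
    and unitary: "unitary_between M (M\<^sup>\<bottom>) U"
begin

lemmas M_closed_ops = subspace_add[OF subspace_M] subspace_scale[OF subspace_M]
  subspace_diff[OF subspace_M]

lemma U_add: "u \<in> M \<Longrightarrow> v \<in> M \<Longrightarrow> U (u + v) = U u + U v"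
  and U_scale: "u \<in> M \<Longrightarrow> U (r *\<^sub>R u) = r *\<^sub>R U u"
  and U_in: "u \<in> M \<Longrightarrow> U u \<in> M\<^sup>\<bottom>"
  using unitary by (auto simp: unitary_between_def bij_betw_def)

lemma orthogonal_U: "u \<in> M \<Longrightarrow> x \<in> M \<Longrightarrow> inner x (U u) = 0"
  using U_in[of u] by (auto simp: orthogonal_comp_def orthogonal_def)

lemma coordinates:
  obtains u x where "u \<in> M" "x \<in> M" "z = U u + x"
proof -
  obtain y x where "y \<in> M\<^sup>\<bottom>" "x \<in> M" "z = y + x"
    using orthogonal_decomposition_closed_subspace[OF closed_M subspace_M] by blast
  moreover obtain u where "u \<in> M" "U u = y"
    using unitary \<open>y \<in> M\<^sup>\<bottom>\<close> by (metis unitary_between_def bij_betw_def imageE)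
  ultimately show thesis using that by blast
qed

lemma parts_coordinates:
  assumes "u \<in> M" "x \<in> M"
  shows "par_part M (U u + x) = x" "perp_part M (U u + x) = U u"
  using decomposition_parts[OF subspace_M _ U_in] assms by auto

lemma sl2_op_coordinates:
  assumes "u \<in> M" "x \<in> M"
  shows "sl2_op M U g (U u + x)
           = U (g$1$1 *\<^sub>R u + g$1$2 *\<^sub>R x) + (g$2$1 *\<^sub>R u + g$2$2 *\<^sub>R x)"
  using assms adjoint_on_unitary[OF subspace_M unitary]
  by (simp add: sl2_op_def parts_coordinates U_add U_scale M_closed_ops)

lemma symplectic_form_coordinates:
  assumes "u \<in> M" "x \<in> M" "u' \<in> M" "x' \<in> M"
  shows "symplectic_form M U (U u + x) (U u' + x') = inner x u' - inner u x'"
  using assms adjoint_on_unitary[OF subspace_M unitary]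
  by (simp add: symplectic_form_def parts_coordinates unitary_between_inner[OF subspace_M unitary])

section \<open>Symplectic complements\<close>

text \<open>
  The vector \<open>u' - U x'\<close> represents the form against \<open>U u' + x'\<close> as an inner product, because
  the cross terms between \<open>M\<close> and its complement vanish.
\<close>
lemma symplectic_form_eq_inner:
  obtains w where "\<And>z. symplectic_form M U z z' = inner w z"
proof -
  obtain u' x' where z': "u' \<in> M" "x' \<in> M" "z' = U u' + x'" using coordinates .
  have "symplectic_form M U z z' = inner (u' - U x') z" for z
  proof -
    obtain u x where "u \<in> M" "x \<in> M" "z = U u + x" using coordinates .
    with z' show ?thesis
      by (simp add: symplectic_form_coordinates inner_diff_left inner_add_right
          unitary_between_inner[OF subspace_M unitary] orthogonal_U inner_commute[of "U _" x]
          inner_commute[of x u'] inner_commute[of u x'])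
  qed
  then show thesis by (rule that)
qed

lemma closed_symplectic_complement: "closed (symplectic_complement M U L)"
proof -
  have "closed {z. symplectic_form M U z z' = 0}" for z'
    by (rule symplectic_form_eq_inner[of z']) (simp add: closed_hyperplane)
  moreover have "symplectic_complement M U L = (\<Inter>z'\<in>L. {z. symplectic_form M U z z' = 0})"
    by (auto simp: symplectic_complement_def)
  ultimately show ?thesis by auto
qed

lemma symplectic_complement_image:
  assumes "surj T"
    and "\<And>z z'. symplectic_form M U (T z) (T z') = symplectic_form M U z z'"
  shows "symplectic_complement M U (T ` L) = T ` symplectic_complement M U L"
proof
  show "symplectic_complement M U (T ` L) \<subseteq> T ` symplectic_complement M U L"
  proof
    fix z assume z: "z \<in> symplectic_complement M U (T ` L)"
    obtain w where "z = T w" using assms(1) by (rule surjE)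
    with z assms(2) show "z \<in> T ` symplectic_complement M U L"
      by (auto simp: symplectic_complement_def)
  qed
qed (use assms(2) in \<open>auto simp: symplectic_complement_def\<close>)

section \<open>The action of two-by-two matrices\<close>

lemma linear_sl2_op: "linear (sl2_op M U g)"
proof (rule linearI)
  fix z z' :: 'h and r :: real
  obtain u x where z: "u \<in> M" "x \<in> M" "z = U u + x" using coordinates .
  obtain u' x' where z': "u' \<in> M" "x' \<in> M" "z' = U u' + x'" using coordinates .
  have "z + z' = U (u + u') + (x + x')" using z z' by (simp add: U_add)
  then have "sl2_op M U g (z + z')
      = U (g$1$1 *\<^sub>R (u + u') + g$1$2 *\<^sub>R (x + x'))
        + (g$2$1 *\<^sub>R (u + u') + g$2$2 *\<^sub>R (x + x'))"
    using z z' by (simp only: sl2_op_coordinates M_closed_ops)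
  also have "\<dots> = sl2_op M U g z + sl2_op M U g z'"
    unfolding z(3) z'(3) sl2_op_coordinates[OF z(1,2)] sl2_op_coordinates[OF z'(1,2)]
    using z(1,2) z'(1,2) by (simp add: U_add U_scale M_closed_ops algebra_simps)
  finally show "sl2_op M U g (z + z') = sl2_op M U g z + sl2_op M U g z'" .
  have "r *\<^sub>R z = U (r *\<^sub>R u) + r *\<^sub>R x" using z by (simp add: U_scale scaleR_add_right)
  then have "sl2_op M U g (r *\<^sub>R z)
      = U (g$1$1 *\<^sub>R r *\<^sub>R u + g$1$2 *\<^sub>R r *\<^sub>R x) + (g$2$1 *\<^sub>R r *\<^sub>R u + g$2$2 *\<^sub>R r *\<^sub>R x)"
    using z by (simp only: sl2_op_coordinates M_closed_ops)
  also have "\<dots> = r *\<^sub>R sl2_op M U g z"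
    unfolding z(3) sl2_op_coordinates[OF z(1,2)]
    using z(1,2) by (simp add: U_add U_scale M_closed_ops algebra_simps)
  finally show "sl2_op M U g (r *\<^sub>R z) = r *\<^sub>R sl2_op M U g z" .
qed

lemma symplectic_form_sl2_op:
  "symplectic_form M U (sl2_op M U g z) (sl2_op M U g z') = det g * symplectic_form M U z z'"
proof -
  obtain u x where z: "u \<in> M" "x \<in> M" "z = U u + x" using coordinates .
  obtain u' x' where z': "u' \<in> M" "x' \<in> M" "z' = U u' + x'" using coordinates .
  show ?thesis
    unfolding z(3) z'(3) sl2_op_coordinates[OF z(1,2)] sl2_op_coordinates[OF z'(1,2)]
    using z(1,2) z'(1,2)
    by (simp add: symplectic_form_coordinates M_closed_ops)
      (simp add: det_2 inner_add_left inner_add_right algebra_simps)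
qed

lemma surj_sl2_op:
  assumes "det g = 1"
  shows "surj (sl2_op M U g)"
proof -
  have "\<exists>w. z = sl2_op M U g w" for z
  proof -
    obtain u x where z: "u \<in> M" "x \<in> M" "z = U u + x" using coordinates .
    \<comment> \<open>The adjugate matrix \<open>(d, -b; -c, a)\<close> applied to \<open>(u, x)\<close>.\<close>
    define u' where "u' = g$2$2 *\<^sub>R u - g$1$2 *\<^sub>R x"
    define x' where "x' = g$1$1 *\<^sub>R x - g$2$1 *\<^sub>R u"
    have M: "u' \<in> M" "x' \<in> M" using z by (auto simp: u'_def x'_def M_closed_ops)
    have "g$1$1 *\<^sub>R u' + g$1$2 *\<^sub>R x' = det g *\<^sub>R u"
         "g$2$1 *\<^sub>R u' + g$2$2 *\<^sub>R x' = det g *\<^sub>R x"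
      by (simp_all add: u'_def x'_def det_2 algebra_simps)
    then have "sl2_op M U g (U u' + x') = z"
      using sl2_op_coordinates[OF M] z assms by simp
    then show ?thesis by metis
  qed
  then show ?thesis by (auto simp: surj_def)
qed

lemma compatible_subspace_sl2_op:
  assumes "compatible_subspace M U N" "det g = 1"
  shows "compatible_subspace M U (sl2_op M U g ` N)"
proof -
  have N: "subspace N" "symplectic_complement M U N = N"
    using assms(1) by (auto simp: compatible_subspace_def lagrangian_def)
  have "symplectic_complement M U (sl2_op M U g ` N) = sl2_op M U g ` N"
    using symplectic_complement_image[OF surj_sl2_op, of g N] symplectic_form_sl2_op assms(2) N(2)
    by simp
  moreover from this have "closed (sl2_op M U g ` N)"
    by (metis closed_symplectic_complement)
  ultimately show ?thesis
    using linear_subspace_image[OF linear_sl2_op N(1)]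
    by (simp add: compatible_subspace_def lagrangian_def)
qed

end

theorem lemma8:
  fixes M N :: "'h::{real_inner, complete_space} set"
    and U :: "'h \<Rightarrow> 'h"
    and g :: "real^2^2"
  assumes "separable_space (euclidean :: 'h topology)"
    and "closed M" and "subspace M"
    and "same_hilbert_dim M (M\<^sup>\<bottom>)"
    and "unitary_between M (M\<^sup>\<bottom>) U"
    and "compatible_subspace M U N"
    and "det g = 1"
  shows "compatible_subspace M U (sl2_op M U g ` N)"
proof -
  interpret unitary_onto_complement M U
    using assms(2,3,5) by unfold_locales
  show ?thesis using assms(6,7) by (rule compatible_subspace_sl2_op)
qed

end
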